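(* Choose $X\in\{\mathrm E,\mathrm M\}$, with $p=1$ for Euler ($X=\mathrm E$) and $p=2$ for midpoint ($X=\mathrm M$). Assume the local defect is bounded by $C_{\rm loc}k^{p+1}$, that is, $$\|\bm m_N(t_{n+1})-\Phi^X_{k,n}(\bm m_N(t_n))\|_N\le C_{\rm loc}k^{p+1},$$ and that the exact one-step map is stable, $$\|\Phi^X_{k,n}(\bm u)-\Phi^X_{k,n}(\bm v)\|_N\le(1+Lk)\|\bm u-\bm v\|_N .$$ Let the computed map $\widetilde\Phi^X_{k,n}$ satisfy $$\|\widetilde\Phi^X_{k,n}(\bm u)-\Phi^X_{k,n}(\bm u)\|_N\le\eta_n .$$ Then, for $t_n=nk\le T$, $$\max_{0\le n\le T/k}\|\bm m_N(t_n)-\widetilde{\bm m}_N^n\|_N\le e^{LT}\Bigl(\|\bm m_N(0)-\widetilde{\bm m}_N^0\|_N+C_{\rm loc}Tk^p+\sum_{j=0}^{T/k-1}\eta_j\Bigr).$$ In particular, if $\eta_n\le\eta$, the algebraic contribution is bounded by $e^{LT}T\eta/k$, and the order $p$ is retained when $\eta=O(k^{p+1})$.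
   Context: Time: $[0,T]$ is partitioned uniformly with step $k$, $t_n=nk$, the last point being $T$ (so $T/k$ is an integer). Grid: uniform periodic Cartesian grid with $N_g$ nodes $\bm x_j$ on $\Omega=\prod_{\ell=1}^d(0,L_\ell)$, $d\in\{2,3\}$; $V_N$ is the corresponding space of trigonometric polynomials identified with grid functions; $(u,v)_N=\frac{|\Omega|}{N_g}\sum_ju(\bm x_j)\cdot v(\bm x_j)$ with norm $\|\cdot\|_N$; products are nodewise; $-\Delta_N$ is the Fourier multiplier $|\bm\xi|^2$. Constants $\alpha,\widehat C_{\rm exc}>0$; $\bm h_{\rm low}$ is the lower-order field with values in $V_N^3$. $\mathcal K_N(\bm m)=\{\bm\phi\in V_N^3:\bm m(\bm x_j)\cdot\bm\phi(\bm x_j)=0\ \forall j\}$. Semidiscrete flow: $\bm m_N:[0,T]\to V_N^3$ solves $\dot{\bm m}_N=F_N(\bm m_N,t)$, where $F_N(\bm m,t)=\bm v\in\mathcal K_N(\bm m)$ is the tangent vector field determined by $\alpha(\bm v,\bm\phi)_N+(\bm m\times\bm v,\bm\phi)_N=-\widehat C_{\rm exc}(-\Delta_N\bm m,\bm\phi)_N+(1+\alpha^2)(\bm h_{\rm low}(\bm m,t),\bm\phi)_N$ for all $\bm\phi\in\mathcal K_N(\bm m)$. $\Phi^{\rm E}_{k,n}$ is the exact one-step map of the projected implicit Euler scheme: find $\bm v\in\mathcal K_N(\bm m)$ with $\alpha(\bm v,\bm\phi)_N+(\bm m\times\bm v,\bm\phi)_N+k\widehat C_{\rm exc}(-\Delta_N\bm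 v,\bm\phi)_N=-\widehat C_{\rm exc}(-\Delta_N\bm m,\bm\phi)_N+(1+\alpha^2)(\bm h_{\rm low}(\bm m),\bm\phi)_N$ for all $\bm\phi\in\mathcal K_N(\bm m)$, then normalize $\bm m+k\bm v$ to unit length at each node. $\Phi^{\rm M}_{k,n}$ is the exact one-step map of the converged midpoint scheme: $\Phi^{\rm M}_{k,n}(\bm m)=\bm m+k\bm v$, where, with $\bm w=\bm m+\frac k2\bm v$ and $t_{n+1/2}=t_n+k/2$, $\bm v\in\mathcal K_N(\bm w)$ satisfies $\alpha(\bm v,\bm\phi)_N+(\bm w\times\bm v,\bm\phi)_N+\widehat C_{\rm exc}(-\Delta_N\bm w,\bm\phi)_N=(1+\alpha^2)(\bm h_{\rm low}(\bm w,t_{n+1/2}),\bm\phi)_N$ for all $\bm\phi\in\mathcal K_N(\bm w)$. $\widetilde\Phi^X_{k,n}$ is the computed (inexactly solved) version of $\Phi^X_{k,n}$, and the computed iterates are $\widetilde{\bm m}_N^{n+1}=\widetilde\Phi^X_{k,n}(\widetilde{\bm m}_N^n)$ from a given $\widetilde{\bm m}_N^0$. The quantities $C_{\rm loc}$ and $L$ are constants. *)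

theory Defs
  imports "HOL-Analysis.Analysis" "HOL-Library.Landau_Symbols"
begin

section \<open>Grid functions\<close>

text \<open>
  A trigonometric polynomial in \<open>V\<^sub>N\<close> is identified with its nodal values.  Nodes are addressed by
  multi-indices \<open>j\<close> with \<open>j l < N l\<close>, where \<open>N l\<close> is the number of nodes in direction \<open>l\<close>.  An element
  of \<open>V\<^sub>N\<^sup>3\<close> is a function on all multi-indices that vanishes off the grid, so that it is uniquely
  determined by its nodal values.
\<close>

type_synonym 'd field = "('d \<Rightarrow> nat) \<Rightarrow> real ^ 3"

definition nodes :: "('d::finite \<Rightarrow> nat) \<Rightarrow> ('d \<Rightarrow> nat) set" where
  "nodes N = {j. \<forall>l. j l < N l}"

definition node_pos :: "real ^ 'd \<Rightarrow> ('d::finite \<Rightarrow> nat) \<Rightarrow> ('d \<Rightarrow> nat) \<Rightarrow> real ^ 'd" where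
  "node_pos len N j = (\<chi> l. real (j l) * len $ l / real (N l))"

definition VN3 :: "('d::finite \<Rightarrow> nat) \<Rightarrow> 'd field set" where
  "VN3 N = {u. \<forall>j. j \<notin> nodes N \<longrightarrow> u j = 0}"

definition inner_N :: "real ^ 'd \<Rightarrow> ('d::finite \<Rightarrow> nat) \<Rightarrow> 'd field \<Rightarrow> 'd field \<Rightarrow> real" where
  "inner_N len N u v =
     (\<Prod>l\<in>UNIV. len $ l) / real (card (nodes N)) * (\<Sum>j\<in>nodes N. u j \<bullet> v j)"

definition norm_N :: "real ^ 'd \<Rightarrow> ('d::finite \<Rightarrow> nat) \<Rightarrow> 'd field \<Rightarrow> real" where
  "norm_N len N u = sqrt (inner_N len N u u)"

definition cross_N :: "'d field \<Rightarrow> 'd field \<Rightarrow> 'd field" where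
  "cross_N u v = (\<lambda>j. cross3 (u j) (v j))"

definition K_N :: "('d::finite \<Rightarrow> nat) \<Rightarrow> 'd field \<Rightarrow> 'd field set" where
  "K_N N m = {\<phi> \<in> VN3 N. \<forall>j\<in>nodes N. m j \<bullet> \<phi> j = 0}"


section \<open>The spectral Laplacian\<close>

text \<open>
  Fourier modes are indexed by the same multi-indices as the nodes; \<open>signed_mode\<close> selects the
  representative of smallest modulus modulo \<open>n\<close>.  At the Nyquist mode of an even \<open>n\<close> the choice between
  \<open>n/2\<close> and \<open>-n/2\<close> affects neither the symbol nor the nodal values.
\<close>

definition signed_mode :: "nat \<Rightarrow> nat \<Rightarrow> int" where
  "signed_mode n i = (if 2 * i \<le> n then int i else int i - int n)"

definition wave :: "real ^ 'd \<Rightarrow> ('d::finite \<Rightarrow> nat) \<Rightarrow> ('d \<Rightarrow> nat) \<Rightarrow> real ^ 'd" where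
  "wave len N i = (\<chi> l. 2 * pi * real_of_int (signed_mode (N l) (i l)) / len $ l)"

definition fourier_coeff ::
    "real ^ 'd \<Rightarrow> ('d::finite \<Rightarrow> nat) \<Rightarrow> (('d \<Rightarrow> nat) \<Rightarrow> real) \<Rightarrow> ('d \<Rightarrow> nat) \<Rightarrow> complex" where
  "fourier_coeff len N u i =
     (\<Sum>j\<in>nodes N. of_real (u j) * cis (- (wave len N i \<bullet> node_pos len N j)))
       / of_nat (card (nodes N))"

text \<open>
  The symbol \<open>|\<xi>|\<^sup>2\<close> is even, so for real-valued \<open>u\<close> the sum below is real and taking its real part only
  changes the type.
\<close>

definition neg_lap_scalar ::
    "real ^ 'd \<Rightarrow> ('d::finite \<Rightarrow> nat) \<Rightarrow> (('d \<Rightarrow> nat) \<Rightarrow> real) \<Rightarrow> ('d \<Rightarrow> nat) \<Rightarrow> real" where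
  "neg_lap_scalar len N u j =
     (if j \<in> nodes N then
        Re (\<Sum>i\<in>nodes N. of_real ((norm (wave len N i))\<^sup>2) * fourier_coeff len N u i
              * cis (wave len N i \<bullet> node_pos len N j))
      else 0)"

definition neg_lap_N :: "real ^ 'd \<Rightarrow> ('d::finite \<Rightarrow> nat) \<Rightarrow> 'd field \<Rightarrow> 'd field" where
  "neg_lap_N len N u = (\<lambda>j. \<chi> c. neg_lap_scalar len N (\<lambda>i. u i $ c) j)"


section \<open>The semidiscrete flow\<close>

definition flow_velocity ::
    "real ^ 'd \<Rightarrow> ('d::finite \<Rightarrow> nat) \<Rightarrow> real \<Rightarrow> real \<Rightarrow> ('d field \<Rightarrow> real \<Rightarrow> 'd field)
      \<Rightarrow> 'd field \<Rightarrow> real \<Rightarrow> 'd field \<Rightarrow> bool" where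
  "flow_velocity len N \<alpha> C\<^sub>e\<^sub>x\<^sub>c h m t v \<longleftrightarrow>
     v \<in> K_N N m \<and>
     (\<forall>\<phi>\<in>K_N N m.
        \<alpha> * inner_N len N v \<phi> + inner_N len N (cross_N m v) \<phi>
          = - C\<^sub>e\<^sub>x\<^sub>c * inner_N len N (neg_lap_N len N m) \<phi> + (1 + \<alpha>\<^sup>2) * inner_N len N (h m t) \<phi>)"

definition F_N ::
    "real ^ 'd \<Rightarrow> ('d::finite \<Rightarrow> nat) \<Rightarrow> real \<Rightarrow> real \<Rightarrow> ('d field \<Rightarrow> real \<Rightarrow> 'd field)
      \<Rightarrow> 'd field \<Rightarrow> real \<Rightarrow> 'd field" where
  "F_N len N \<alpha> C\<^sub>e\<^sub>x\<^sub>c h m t = (THE v. flow_velocity len N \<alpha> C\<^sub>e\<^sub>x\<^sub>c h m t v)"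

definition semidiscrete_flow ::
    "real ^ 'd \<Rightarrow> ('d::finite \<Rightarrow> nat) \<Rightarrow> real \<Rightarrow> real \<Rightarrow> ('d field \<Rightarrow> real \<Rightarrow> 'd field)
      \<Rightarrow> real \<Rightarrow> (real \<Rightarrow> 'd field) \<Rightarrow> bool" where
  "semidiscrete_flow len N \<alpha> C\<^sub>e\<^sub>x\<^sub>c h T m \<longleftrightarrow>
     (\<forall>t\<in>{0..T}. m t \<in> VN3 N \<and>
        (\<forall>j. ((\<lambda>s. m s j) has_vector_derivative F_N len N \<alpha> C\<^sub>e\<^sub>x\<^sub>c h (m t) t j)
              (at t within {0..T})))"


section \<open>The one-step maps\<close>

datatype scheme = Euler | Midpoint

fun scheme_order :: "scheme \<Rightarrow> nat" where
  "scheme_order Euler = 1"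
| "scheme_order Midpoint = 2"

text \<open>
  \<open>exact_step X len N \<alpha> C\<^sub>e\<^sub>x\<^sub>c h k n m m'\<close> says that one exact step of scheme \<open>X\<close> with step size \<open>k\<close> from
  \<open>m\<close> at time \<open>t\<^sub>n = n k\<close> leads to \<open>m'\<close>.  A relation is used because the nonlinear midpoint equation need
  not be uniquely solvable, and because a nodal value that is zero cannot be normalized.  The Euler
  scheme is explicit in the lower-order field, which is taken at \<open>t\<^sub>n\<close>.  On vectors, \<open>sgn x\<close> is
  \<open>x / norm x\<close>.
\<close>

fun exact_step ::
    "scheme \<Rightarrow> real ^ 'd \<Rightarrow> ('d::finite \<Rightarrow> nat) \<Rightarrow> real \<Rightarrow> real \<Rightarrow> ('d field \<Rightarrow> real \<Rightarrow> 'd field)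
      \<Rightarrow> real \<Rightarrow> nat \<Rightarrow> 'd field \<Rightarrow> 'd field \<Rightarrow> bool" where
  "exact_step Euler len N \<alpha> C\<^sub>e\<^sub>x\<^sub>c h k n m m' \<longleftrightarrow>
     (\<exists>v\<in>K_N N m.
        (\<forall>\<phi>\<in>K_N N m.
           \<alpha> * inner_N len N v \<phi> + inner_N len N (cross_N m v) \<phi>
               + k * C\<^sub>e\<^sub>x\<^sub>c * inner_N len N (neg_lap_N len N v) \<phi>
             = - C\<^sub>e\<^sub>x\<^sub>c * inner_N len N (neg_lap_N len N m) \<phi>
               + (1 + \<alpha>\<^sup>2) * inner_N len N (h m (real n * k)) \<phi>) \<and>
        (\<forall>j\<in>nodes N. m j + k *\<^sub>R v j \<noteq> 0) \<and>
        m' = (\<lambda>j. sgn (m j + k *\<^sub>R v j)))"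
| "exact_step Midpoint len N \<alpha> C\<^sub>e\<^sub>x\<^sub>c h k n m m' \<longleftrightarrow>
     (\<exists>v w. w = (\<lambda>j. m j + (k / 2) *\<^sub>R v j) \<and> v \<in> K_N N w \<and>
        (\<forall>\<phi>\<in>K_N N w.
           \<alpha> * inner_N len N v \<phi> + inner_N len N (cross_N w v) \<phi>
               + C\<^sub>e\<^sub>x\<^sub>c * inner_N len N (neg_lap_N len N w) \<phi>
             = (1 + \<alpha>\<^sup>2) * inner_N len N (h w (real n * k + k / 2)) \<phi>) \<and>
        m' = (\<lambda>j. m j + k *\<^sub>R v j))"


section \<open>Time grid and error\<close>

definition admissible_step :: "real \<Rightarrow> real \<Rightarrow> bool" where
  "admissible_step T k \<longleftrightarrow> 0 < k \<and> T / k \<in> \<nat>"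

text \<open>For an admissible step the floor is exact.\<close>

definition nsteps :: "real \<Rightarrow> real \<Rightarrow> nat" where
  "nsteps T k = nat \<lfloor>T / k\<rfloor>"

definition err_N ::
    "real ^ 'd \<Rightarrow> ('d::finite \<Rightarrow> nat) \<Rightarrow> (real \<Rightarrow> 'd field) \<Rightarrow> (nat \<Rightarrow> 'd field) \<Rightarrow> real \<Rightarrow> nat \<Rightarrow> real" where
  "err_N len N m mt k n = norm_N len N (\<lambda>j. m (real n * k) j - mt n j)"

definition max_err_N ::
    "real ^ 'd \<Rightarrow> ('d::finite \<Rightarrow> nat) \<Rightarrow> real \<Rightarrow> (real \<Rightarrow> 'd field) \<Rightarrow> (nat \<Rightarrow> 'd field) \<Rightarrow> real \<Rightarrow> real" where
  "max_err_N len N T m mt k = Max (err_N len N m mt k ` {0..nsteps T k})"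


section \<open>The flow velocity is well defined\<close>

lemma finite_nodes: "finite (nodes N)"
proof -
  have "nodes N = Pi\<^sub>E UNIV (\<lambda>l. {..<N l})"
    by (auto simp: nodes_def PiE_def)
  then show ?thesis
    by (simp add: finite_PiE)
qed

lemma flow_velocity_nodal:
  fixes m g :: "real ^ 3"
  assumes "\<alpha> > 0"
  shows "\<exists>v. m \<bullet> v = 0 \<and> (\<forall>\<phi>. m \<bullet> \<phi> = 0 \<longrightarrow> \<alpha> * (v \<bullet> \<phi>) + cross3 m v \<bullet> \<phi> = g \<bullet> \<phi>)"
proof (cases "m = 0")
  case True
  then show ?thesis
    using assms by (intro exI[of _ "(1 / \<alpha>) *\<^sub>R g"]) auto
next
  case False
  define q where "q = m \<bullet> m"
  have q: "q > 0" using False by (simp add: q_def)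
  define w where "w = \<alpha> *\<^sub>R (g - ((m \<bullet> g) / q) *\<^sub>R m) - cross3 m g"
  define s where "s = \<alpha>\<^sup>2 + q"
  have s: "s > 0" using q by (simp add: s_def add_nonneg_pos)
  have w1: "m \<bullet> w = 0"
    using q by (simp add: w_def inner_diff_right q_def[symmetric] dot_cross_self)
  have "cross3 m w = \<alpha> *\<^sub>R cross3 m g - cross3 m (cross3 m g)"
    by (simp add: w_def cross_mult_right right_diff_distrib Cross3.right_diff_distrib)
  also have "cross3 m (cross3 m g) = (m \<bullet> g) *\<^sub>R m - q *\<^sub>R g"
    by (simp add: Lagrange q_def)
  finally have cw: "cross3 m w = \<alpha> *\<^sub>R cross3 m g - ((m \<bullet> g) *\<^sub>R m - q *\<^sub>R g)" .
  have "\<alpha> * (w \<bullet> \<phi>) + cross3 m w \<bullet> \<phi> = s * (g \<bullet> \<phi>)" if "m \<bullet> \<phi> = 0" for \<phi>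
    unfolding cw using that
    by (simp add: w_def s_def inner_diff_left power2_eq_square algebra_simps)
  then show ?thesis
    using s w1
    by (intro exI[of _ "(1 / s) *\<^sub>R w"])
       (auto simp: cross_mult_right field_simps)
qed

lemma flow_velocity_ex1:
  fixes len :: "real ^ 'd" and N :: "'d::finite \<Rightarrow> nat"
  assumes "\<alpha> > 0" and len: "\<And>l. len $ l > 0" and N: "\<And>l. N l > 0"
  shows "\<exists>!v. flow_velocity len N \<alpha> C\<^sub>e\<^sub>x\<^sub>c h m t v"
proof -
  define c where "c = (\<Prod>l\<in>UNIV. len $ l) / real (card (nodes N))"
  have "(\<lambda>l. 0) \<in> nodes N" using N by (simp add: nodes_def)
  then have "card (nodes N) > 0" using finite_nodes card_gt_0_iff by blast
  moreover have "(\<Prod>l\<in>UNIV. len $ l) > 0" using len by (intro prod_pos) auto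
  ultimately have c: "c > 0" by (simp add: c_def)
  have ip: "inner_N len N u v = c * (\<Sum>j\<in>nodes N. u j \<bullet> v j)" for u v :: "'d field"
    by (simp add: inner_N_def c_def)
  define g where "g = (\<lambda>j. - C\<^sub>e\<^sub>x\<^sub>c *\<^sub>R neg_lap_N len N m j + (1 + \<alpha>\<^sup>2) *\<^sub>R h m t j)"
  have eq: "flow_velocity len N \<alpha> C\<^sub>e\<^sub>x\<^sub>c h m t v \<longleftrightarrow> v \<in> K_N N m \<and>
      (\<forall>\<phi>\<in>K_N N m. (\<Sum>j\<in>nodes N. \<alpha> * (v j \<bullet> \<phi> j) + cross3 (m j) (v j) \<bullet> \<phi> j)
         = (\<Sum>j\<in>nodes N. g j \<bullet> \<phi> j))" for v
  proof -
    have "\<alpha> * inner_N len N v \<phi> + inner_N len N (cross_N m v) \<phi>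
        = c * (\<Sum>j\<in>nodes N. \<alpha> * (v j \<bullet> \<phi> j) + cross3 (m j) (v j) \<bullet> \<phi> j)" for \<phi>
      by (simp add: ip cross_N_def sum.distrib sum_distrib_left[symmetric] algebra_simps)
    moreover have "- C\<^sub>e\<^sub>x\<^sub>c * inner_N len N (neg_lap_N len N m) \<phi> + (1 + \<alpha>\<^sup>2) * inner_N len N (h m t) \<phi>
        = c * (\<Sum>j\<in>nodes N. g j \<bullet> \<phi> j)" for \<phi>
    proof -
      have "(\<Sum>j\<in>nodes N. g j \<bullet> \<phi> j) = - C\<^sub>e\<^sub>x\<^sub>c * (\<Sum>j\<in>nodes N. neg_lap_N len N m j \<bullet> \<phi> j)
          + (1 + \<alpha>\<^sup>2) * (\<Sum>j\<in>nodes N. h m t j \<bullet> \<phi> j)"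
        unfolding sum_distrib_left sum.distrib[symmetric]
        by (intro sum.cong refl) (simp add: g_def inner_add_left inner_diff_left)
      then show ?thesis by (simp only: ip) (simp add: algebra_simps)
    qed
    ultimately show ?thesis
      using c by (simp add: flow_velocity_def)
  qed
  have "\<exists>v. m j \<bullet> v = 0 \<and>
      (\<forall>\<phi>. m j \<bullet> \<phi> = 0 \<longrightarrow> \<alpha> * (v \<bullet> \<phi>) + cross3 (m j) v \<bullet> \<phi> = g j \<bullet> \<phi>)" for j
    using flow_velocity_nodal[OF \<open>\<alpha> > 0\<close>] .
  then obtain v where v: "\<And>j. m j \<bullet> v j = 0"
    "\<And>j \<phi>. m j \<bullet> \<phi> = 0 \<Longrightarrow> \<alpha> * (v j \<bullet> \<phi>) + cross3 (m j) (v j) \<bullet> \<phi> = g j \<bullet> \<phi>"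
    by metis
  show ?thesis
  proof (rule ex_ex1I)
    show "\<exists>v. flow_velocity len N \<alpha> C\<^sub>e\<^sub>x\<^sub>c h m t v"
      unfolding eq using v
      by (intro exI[of _ "\<lambda>j. if j \<in> nodes N then v j else 0"])
         (auto simp: K_N_def VN3_def intro!: sum.cong)
  next
    fix v w
    assume a: "flow_velocity len N \<alpha> C\<^sub>e\<^sub>x\<^sub>c h m t v" and b: "flow_velocity len N \<alpha> C\<^sub>e\<^sub>x\<^sub>c h m t w"
    define d where "d = (\<lambda>j. v j - w j)"
    have d: "d \<in> K_N N m"
      using a b by (auto simp: eq K_N_def VN3_def d_def inner_diff_right)
    have "(\<Sum>j\<in>nodes N. \<alpha> * (v j \<bullet> d j) + cross3 (m j) (v j) \<bullet> d j)
        - (\<Sum>j\<in>nodes N. \<alpha> * (w j \<bullet> d j) + cross3 (m j) (w j) \<bullet> d j) = 0"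
      using a b d by (simp add: eq)
    moreover have "\<alpha> * (v j \<bullet> d j) + cross3 (m j) (v j) \<bullet> d j
        - (\<alpha> * (w j \<bullet> d j) + cross3 (m j) (w j) \<bullet> d j) = \<alpha> * (d j \<bullet> d j)" for j
    proof -
      have "cross3 (m j) (v j) \<bullet> d j - cross3 (m j) (w j) \<bullet> d j = cross3 (m j) (d j) \<bullet> d j"
        by (simp add: d_def Cross3.right_diff_distrib inner_diff_left)
      moreover have "v j \<bullet> d j - w j \<bullet> d j = d j \<bullet> d j"
        by (simp add: d_def inner_diff_left)
      ultimately show ?thesis
        by (simp add: dot_cross_self algebra_simps flip: right_diff_distrib)
    qed
    ultimately have "(\<Sum>j\<in>nodes N. \<alpha> * (d j \<bullet> d j)) = 0"
      by (simp add: sum_subtractf[symmetric])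
    then have "\<forall>j\<in>nodes N. \<alpha> * (d j \<bullet> d j) = 0"
      using \<open>\<alpha> > 0\<close> by (subst (asm) sum_nonneg_eq_0_iff) (auto simp: finite_nodes)
    then have "d j = 0" for j
      using d \<open>\<alpha> > 0\<close> by (cases "j \<in> nodes N") (auto simp: K_N_def VN3_def)
    then show "v = w" by (auto simp: d_def)
  qed
qed

end

theory Submission
  imports Defs
begin

text \<open>
  Inserting \<open>\<Phi>(m(t\<^sub>n))\<close> and \<open>\<Phi>(mt\<^sub>n)\<close> between the exact and the computed solution at step \<open>n + 1\<close> gives
  \<open>e\<^sub>n\<^sub>+\<^sub>1 \<le> (1 + L k) e\<^sub>n + C\<^sub>l\<^sub>o\<^sub>c k\<^bsup>p+1\<^esup> + \<eta>\<^sub>n\<close> by the defect, stability and inexactness bounds.  The discrete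
  Gronwall inequality sums this up, and \<open>(1 + L k)\<^bsup>n\<^esup> \<le> e\<^bsup>L T\<^esup>\<close> while \<open>T / k\<close> local errors of size
  \<open>k\<^bsup>p+1\<^esup>\<close> add up to \<open>T k\<^bsup>p\<^esup>\<close>.
\<close>

text \<open>Gives access to Minkowski's inequality for \<open>L2_set\<close>. The weight splits off
  without a sign condition because HOL's \<open>sqrt\<close> is multiplicative on all reals.\<close>

lemma norm_N_eq_L2_set:
  "norm_N len N u =
     sqrt ((\<Prod>l\<in>UNIV. len $ l) / real (card (nodes N))) * L2_set (\<lambda>j. norm (u j)) (nodes N)"
  by (simp only: norm_N_def inner_N_def L2_set_def real_sqrt_mult power2_norm_eq_inner)

text \<open>HOL's \<open>sqrt\<close> is negative on negative arguments, so the sign of the weight,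
  and hence of the side lengths, matters here.\<close>

lemma norm_N_nonneg:
  assumes "\<And>l. len $ l \<ge> 0"
  shows "norm_N len N u \<ge> 0"
  unfolding norm_N_eq_L2_set using assms
  by (intro mult_nonneg_nonneg real_sqrt_ge_zero divide_nonneg_nonneg prod_nonneg L2_set_nonneg) auto

lemma norm_N_minus_commute:
  "norm_N len N (\<lambda>j. u j - v j) = norm_N len N (\<lambda>j. v j - u j)"
  by (simp add: norm_N_eq_L2_set norm_minus_commute)

lemma norm_N_triangle:
  assumes "\<And>l. len $ l \<ge> 0"
  shows "norm_N len N (\<lambda>j. u j + v j) \<le> norm_N len N u + norm_N len N v"
proof -
  let ?L = "\<lambda>f. L2_set f (nodes N)"
  have "?L (\<lambda>j. norm (u j + v j)) \<le> ?L (\<lambda>j. norm (u j) + norm (v j))"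
    by (intro L2_set_mono norm_triangle_ineq norm_ge_zero)
  also have "\<dots> \<le> ?L (\<lambda>j. norm (u j)) + ?L (\<lambda>j. norm (v j))"
    by (rule L2_set_triangle_ineq)
  finally show ?thesis
    unfolding norm_N_eq_L2_set distrib_left[symmetric] using assms
    by (intro mult_left_mono real_sqrt_ge_zero divide_nonneg_nonneg prod_nonneg) auto
qed

lemma norm_N_triangle_diff:
  assumes "\<And>l. len $ l \<ge> 0"
  shows "norm_N len N (\<lambda>j. u j - w j)
    \<le> norm_N len N (\<lambda>j. u j - v j) + norm_N len N (\<lambda>j. v j - w j)"
  using norm_N_triangle[OF assms, where u = "\<lambda>j. u j - v j" and v = "\<lambda>j. v j - w j"] by simp

text \<open>A perturbation entering at step j is amplified only by the later steps; bounding every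
  such factor by the full power \<open>(1 + a) ^ n\<close> keeps the sum unweighted.\<close>

lemma discrete_gronwall:
  fixes e b :: "nat \<Rightarrow> real"
  assumes "a \<ge> 0"
    and step: "\<And>n. n < M \<Longrightarrow> e (Suc n) \<le> (1 + a) * e n + b n"
    and b: "\<And>n. n < M \<Longrightarrow> b n \<ge> 0"
    and "n \<le> M"
  shows "e n \<le> (1 + a) ^ n * (e 0 + (\<Sum>j<n. b j))"
  using \<open>n \<le> M\<close>
proof (induction n)
  case 0
  then show ?case by simp
next
  case (Suc n)
  have "e (Suc n) \<le> (1 + a) * e n + b n"
    using Suc.prems by (intro step) auto
  \<comment> \<open>The new perturbation is inflated by a factor at least 1, so that the same power
    can be factored out of all terms. This uses \<open>b n \<ge> 0\<close>.\<close>
  also have "\<dots> \<le> (1 + a) * ((1 + a) ^ n * (e 0 + (\<Sum>j<n. b j))) + (1 + a) ^ Suc n * b n"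
  proof (rule add_mono)
    show "(1 + a) * e n \<le> (1 + a) * ((1 + a) ^ n * (e 0 + (\<Sum>j<n. b j)))"
      using Suc \<open>a \<ge> 0\<close> by (intro mult_left_mono) auto
    have "(1 + a) ^ Suc n \<ge> 1"
      using \<open>a \<ge> 0\<close> by (intro one_le_power) simp
    then show "b n \<le> (1 + a) ^ Suc n * b n"
      using b[of n] Suc.prems mult_right_mono[of 1 "(1 + a) ^ Suc n" "b n"] by simp
  qed
  also have "\<dots> = (1 + a) ^ Suc n * (e 0 + (\<Sum>j<Suc n. b j))"
    by (simp add: algebra_simps)
  finally show ?case .
qed

lemma discrete_gronwall_exp:
  fixes e b :: "nat \<Rightarrow> real"
  assumes "a \<ge> 0" "e 0 \<ge> 0"
    and step: "\<And>n. n < M \<Longrightarrow> e (Suc n) \<le> (1 + a) * e n + b n"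
    and b: "\<And>n. n < M \<Longrightarrow> b n \<ge> 0"
    and "n \<le> M"
  shows "e n \<le> exp (a * real M) * (e 0 + (\<Sum>j<M. b j))"
proof -
  have "e n \<le> (1 + a) ^ n * (e 0 + (\<Sum>j<n. b j))"
    using assms by (intro discrete_gronwall[where M = M]) auto
  also have "\<dots> \<le> exp (a * real M) * (e 0 + (\<Sum>j<M. b j))"
  proof (rule mult_mono)
    \<comment> \<open>Raising the exponent to \<open>M\<close> makes the bound independent of
      \<open>n\<close>, as needed for the maximum over all time levels.\<close>
    have "(1 + a) ^ n \<le> (1 + a) ^ M"
      using \<open>n \<le> M\<close> \<open>a \<ge> 0\<close> by (intro power_increasing) auto
    also have "\<dots> \<le> exp a ^ M"
      using \<open>a \<ge> 0\<close> by (intro power_mono exp_ge_add_one_self) auto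
    finally show "(1 + a) ^ n \<le> exp (a * real M)"
      by (simp add: exp_of_nat_mult[symmetric] mult.commute)
    show "e 0 + (\<Sum>j<n. b j) \<le> e 0 + (\<Sum>j<M. b j)"
      using \<open>n \<le> M\<close> b by (intro add_left_mono sum_mono2) auto
    show "0 \<le> e 0 + (\<Sum>j<n. b j)"
      using \<open>n \<le> M\<close> b \<open>e 0 \<ge> 0\<close> by (intro add_nonneg_nonneg sum_nonneg) auto
  qed simp
  finally show ?thesis .
qed

lemma nsteps_mult:
  assumes "admissible_step T k"
  shows "real (nsteps T k) * k = T"
proof -
  obtain q where "T / k = real q" and "k > 0"
    using assms by (auto simp: admissible_step_def Nats_def)
  then show ?thesis
    by (simp add: nsteps_def field_simps)
qed

lemma max_err_N_le:
  assumes "\<And>n. n \<le> nsteps T k \<Longrightarrow> err_N len N m mt k n \<le> B"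
  shows "max_err_N len N T m mt k \<le> B"
  unfolding max_err_N_def using assms by (subst Max_le_iff) auto

text \<open>Removes the absolute value from the error in the Landau estimate.\<close>

lemma max_err_N_nonneg:
  assumes "\<And>l. len $ l \<ge> 0"
  shows "max_err_N len N T m mt k \<ge> 0"
proof -
  have "0 \<le> err_N len N m mt k 0"
    unfolding err_N_def by (rule norm_N_nonneg[OF assms])
  also have "\<dots> \<le> max_err_N len N T m mt k"
    unfolding max_err_N_def by (intro Max_ge) auto
  finally show ?thesis .
qed

text \<open>The order claim is asymptotic, so the step size ranges over a set \<K>, with the
  stability and defect constants shared by all its members. \<Phi> selects one solution of the
  relation \<open>exact_step\<close> on \<open>D k\<close>, a set containing both trajectories at
  all times from which a step is taken.\<close>

theorem theorem2:
  fixes len :: "real ^ 'd::finite" and N :: "'d \<Rightarrow> nat"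
    and \<alpha> C\<^sub>e\<^sub>x\<^sub>c T C\<^sub>l\<^sub>o\<^sub>c L :: real
    and h :: "'d field \<Rightarrow> real \<Rightarrow> 'd field"
    and m :: "real \<Rightarrow> 'd field"
    and X :: scheme
    and \<K> :: "real set"
    and D :: "real \<Rightarrow> 'd field set"
    and \<Phi> \<Phi>' :: "real \<Rightarrow> nat \<Rightarrow> 'd field \<Rightarrow> 'd field"
    and mt :: "real \<Rightarrow> nat \<Rightarrow> 'd field"
    and \<eta> :: "real \<Rightarrow> nat \<Rightarrow> real"
  assumes "CARD('d) = 2 \<or> CARD('d) = 3"
    and "\<And>l. len $ l > 0" and "\<And>l. N l > 0"
    and "\<alpha> > 0" and "C\<^sub>e\<^sub>x\<^sub>c > 0" and "T > 0" and "L \<ge> 0"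
    and "\<And>u t. u \<in> VN3 N \<Longrightarrow> t \<in> {0..T} \<Longrightarrow> h u t \<in> VN3 N"
    and flow: "semidiscrete_flow len N \<alpha> C\<^sub>e\<^sub>x\<^sub>c h T m"
    and steps: "\<And>k. k \<in> \<K> \<Longrightarrow> admissible_step T k"
    and domain: "\<And>k. k \<in> \<K> \<Longrightarrow> D k \<subseteq> VN3 N"
      "\<And>k n. k \<in> \<K> \<Longrightarrow> n < nsteps T k \<Longrightarrow> m (real n * k) \<in> D k"
      "\<And>k n. k \<in> \<K> \<Longrightarrow> n < nsteps T k \<Longrightarrow> mt k n \<in> D k"
    and exact: "\<And>k n u. k \<in> \<K> \<Longrightarrow> n < nsteps T k \<Longrightarrow> u \<in> D k \<Longrightarrow>
      exact_step X len N \<alpha> C\<^sub>e\<^sub>x\<^sub>c h k n u (\<Phi> k n u)"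
    and computed: "\<And>k n. k \<in> \<K> \<Longrightarrow> n < nsteps T k \<Longrightarrow> mt k (Suc n) = \<Phi>' k n (mt k n)"
    and defect: "\<And>k n. k \<in> \<K> \<Longrightarrow> n < nsteps T k \<Longrightarrow>
      norm_N len N (\<lambda>j. m (real (Suc n) * k) j - \<Phi> k n (m (real n * k)) j)
        \<le> C\<^sub>l\<^sub>o\<^sub>c * k ^ (scheme_order X + 1)"
    and stable: "\<And>k n u v. k \<in> \<K> \<Longrightarrow> n < nsteps T k \<Longrightarrow> u \<in> D k \<Longrightarrow> v \<in> D k \<Longrightarrow>
      norm_N len N (\<lambda>j. \<Phi> k n u j - \<Phi> k n v j) \<le> (1 + L * k) * norm_N len N (\<lambda>j. u j - v j)"
    and inexact: "\<And>k n u. k \<in> \<K> \<Longrightarrow> n < nsteps T k \<Longrightarrow> u \<in> D k \<Longrightarrow>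
      norm_N len N (\<lambda>j. \<Phi>' k n u j - \<Phi> k n u j) \<le> \<eta> k n"
  shows
    "(\<forall>k\<in>\<K>. max_err_N len N T m (mt k) k
        \<le> exp (L * T) * (norm_N len N (\<lambda>j. m 0 j - mt k 0 j) + C\<^sub>l\<^sub>o\<^sub>c * T * k ^ scheme_order X
             + (\<Sum>j<nsteps T k. \<eta> k j))) \<and>
     (\<forall>k\<in>\<K>. \<forall>\<eta>\<^sub>0. (\<forall>n<nsteps T k. \<eta> k n \<le> \<eta>\<^sub>0) \<longrightarrow>
        exp (L * T) * (\<Sum>j<nsteps T k. \<eta> k j) \<le> exp (L * T) * T * \<eta>\<^sub>0 / k) \<and>
     (\<forall>\<eta>\<^sub>0 :: real \<Rightarrow> real.
        (\<forall>k\<in>\<K>. \<forall>n<nsteps T k. \<eta> k n \<le> \<eta>\<^sub>0 k) \<and>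
        \<eta>\<^sub>0 \<in> O[at 0 within \<K>](\<lambda>k. k ^ (scheme_order X + 1)) \<longrightarrow>
        (\<exists>C. \<forall>\<^sub>F k in at 0 within \<K>. max_err_N len N T m (mt k) k
           \<le> exp (L * T) * (norm_N len N (\<lambda>j. m 0 j - mt k 0 j) + C * k ^ scheme_order X)) \<and>
        ((\<lambda>k. norm_N len N (\<lambda>j. m 0 j - mt k 0 j)) \<in> O[at 0 within \<K>](\<lambda>k. k ^ scheme_order X) \<longrightarrow>
         (\<lambda>k. max_err_N len N T m (mt k) k) \<in> O[at 0 within \<K>](\<lambda>k. k ^ scheme_order X)))"
proof -
  define p where "p = scheme_order X"
  define e0 where "e0 k = norm_N len N (\<lambda>j. m 0 j - mt k 0 j)" for k
  define E where "E k = max_err_N len N T m (mt k) k" for k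
  have len: "\<And>l. len $ l \<ge> 0"
    using assms(2) less_imp_le by blast
  have e0: "e0 k \<ge> 0" for k
    unfolding e0_def by (rule norm_N_nonneg[OF len])
  have k: "k > 0" "real (nsteps T k) * k = T" if "k \<in> \<K>" for k
    using steps[OF that] nsteps_mult[OF steps[OF that]] by (auto simp: admissible_step_def)

  have bound: "E k \<le> exp (L * T) * (e0 k + C\<^sub>l\<^sub>o\<^sub>c * T * k ^ p + (\<Sum>j<nsteps T k. \<eta> k j))"
    if "k \<in> \<K>" for k
  proof -
    let ?M = "nsteps T k"
    let ?e = "err_N len N m (mt k) k"
    let ?b = "\<lambda>n. C\<^sub>l\<^sub>o\<^sub>c * k ^ (p + 1) + \<eta> k n"
    have step: "?e (Suc n) \<le> (1 + L * k) * ?e n + ?b n" if n: "n < ?M" for n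
    proof -
      let ?u = "m (real n * k)" and ?u' = "m (real (Suc n) * k)"
      let ?v = "mt k n" and ?\<Phi> = "\<Phi> k n"
      have D: "?u \<in> D k" "?v \<in> D k"
        using domain \<open>k \<in> \<K>\<close> n by auto
      have "?e (Suc n) = norm_N len N (\<lambda>j. ?u' j - \<Phi>' k n ?v j)"
        by (simp only: err_N_def computed[OF \<open>k \<in> \<K>\<close> n])
      also have "\<dots> \<le> norm_N len N (\<lambda>j. ?u' j - ?\<Phi> ?u j)
          + (norm_N len N (\<lambda>j. ?\<Phi> ?u j - ?\<Phi> ?v j)
          + norm_N len N (\<lambda>j. ?\<Phi> ?v j - \<Phi>' k n ?v j))"
        by (rule order_trans[OF norm_N_triangle_diff[OF len] add_left_mono[OF norm_N_triangle_diff[OF len]]])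
      also have "\<dots> \<le> C\<^sub>l\<^sub>o\<^sub>c * k ^ (p + 1) + ((1 + L * k) * ?e n + \<eta> k n)"
        unfolding p_def err_N_def using D \<open>k \<in> \<K>\<close> n
        by (intro add_mono defect stable) (simp_all add: norm_N_minus_commute[where u = "?\<Phi> ?v"] inexact)
      finally show ?thesis by simp
    qed
    \<comment> \<open>Both summands of \<open>?b n\<close> are nonnegative because each dominates a
      discrete norm along the trajectories.\<close>
    have b: "?b n \<ge> 0" if n: "n < ?M" for n
      using order_trans[OF norm_N_nonneg[OF len] defect[OF \<open>k \<in> \<K>\<close> n]]
        order_trans[OF norm_N_nonneg[OF len] inexact[OF \<open>k \<in> \<K>\<close> n domain(3)[OF \<open>k \<in> \<K>\<close> n]]]
      by (simp add: p_def)
    have sum_b: "(\<Sum>j<?M. ?b j) = C\<^sub>l\<^sub>o\<^sub>c * T * k ^ p + (\<Sum>j<?M. \<eta> k j)"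
    proof -
      have "real ?M * (C\<^sub>l\<^sub>o\<^sub>c * k ^ (p + 1)) = C\<^sub>l\<^sub>o\<^sub>c * (real ?M * k) * k ^ p"
        by (simp add: algebra_simps)
      then show ?thesis
        using k[OF \<open>k \<in> \<K>\<close>] by (simp add: sum.distrib)
    qed
    \<comment> \<open>Gronwall is applied with \<open>a = L * k\<close>; since \<open>?M\<close>
      steps of size \<open>k\<close> fill the interval, the exponent is
      \<open>L * T\<close>.\<close>
    have "?e n \<le> exp (L * k * real ?M) * (?e 0 + (\<Sum>j<?M. ?b j))" if "n \<le> ?M" for n
      using step b that \<open>L \<ge> 0\<close> k[OF \<open>k \<in> \<K>\<close>]
      by (intro discrete_gronwall_exp) (auto simp: err_N_def intro: norm_N_nonneg[OF len])
    moreover have "L * k * real ?M = L * T"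
      using k[OF \<open>k \<in> \<K>\<close>] by (simp add: mult.assoc mult.commute[of k])
    moreover have "?e 0 = e0 k"
      by (simp add: err_N_def e0_def)
    ultimately show ?thesis
      unfolding E_def by (intro max_err_N_le) (simp only: sum_b add.assoc)
  qed

  have sum_\<eta>: "(\<Sum>j<nsteps T k. \<eta> k j) \<le> T * c / k"
    if "k \<in> \<K>" "\<forall>n<nsteps T k. \<eta> k n \<le> c" for k c
  proof -
    have "(\<Sum>j<nsteps T k. \<eta> k j) \<le> real (nsteps T k) * c"
      using sum_bounded_above[of "{..<nsteps T k}" "\<eta> k" c] that by simp
    also have "real (nsteps T k) = T / k"
      using k[OF \<open>k \<in> \<K>\<close>] by (simp add: field_simps)
    finally show ?thesis by simp
  qed

  have order: "(\<exists>C. \<forall>\<^sub>F k in at 0 within \<K>. E k \<le> exp (L * T) * (e0 k + C * k ^ p)) \<and>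
      (e0 \<in> O[at 0 within \<K>](\<lambda>k. k ^ p) \<longrightarrow> E \<in> O[at 0 within \<K>](\<lambda>k. k ^ p))"
    if \<eta>: "\<forall>k\<in>\<K>. \<forall>n<nsteps T k. \<eta> k n \<le> \<eta>\<^sub>0 k"
      and O: "\<eta>\<^sub>0 \<in> O[at 0 within \<K>](\<lambda>k. k ^ (p + 1))" for \<eta>\<^sub>0 :: "real \<Rightarrow> real"
  proof -
    obtain c where c: "\<forall>\<^sub>F k in at 0 within \<K>. norm (\<eta>\<^sub>0 k) \<le> c * norm (k ^ (p + 1))"
      using O by (elim landau_o.bigE)
    \<comment> \<open>Members of \<K> are positive, so this filter describes k tending to 0 from
      above; if 0 is not a limit point of \<K>, it is trivial.\<close>
    have in_\<K>: "\<forall>\<^sub>F k in at 0 within \<K>. k \<in> \<K>"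
      by (simp add: eventually_at_filter)
    \<comment> \<open>The first summand collects the local defects, the second the solver errors,
      with \<open>c\<close> the constant of the O-bound on \<open>\<eta>\<^sub>0\<close>.\<close>
    let ?C = "C\<^sub>l\<^sub>o\<^sub>c * T + T * c"
    have ev: "\<forall>\<^sub>F k in at 0 within \<K>. E k \<le> exp (L * T) * (e0 k + ?C * k ^ p)"
      using c in_\<K>
    proof eventually_elim
      case (elim k)
      have "(\<Sum>j<nsteps T k. \<eta> k j) \<le> T * \<eta>\<^sub>0 k / k"
        using \<eta> elim by (intro sum_\<eta>) auto
      \<comment> \<open>Only the upper half of the bound on the norm of
        \<open>\<eta>\<^sub>0 k\<close> is used; \<open>k > 0\<close> removes the norm on the
        right.\<close>
      also have "\<dots> \<le> T * (c * k ^ (p + 1)) / k"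
        using elim k(1)[OF elim(2)] \<open>T > 0\<close>
        by (intro divide_right_mono mult_left_mono) auto
      also have "\<dots> = T * c * k ^ p"
        using k(1)[OF elim(2)] by simp
      finally have "e0 k + C\<^sub>l\<^sub>o\<^sub>c * T * k ^ p + (\<Sum>j<nsteps T k. \<eta> k j) \<le> e0 k + ?C * k ^ p"
        by (simp add: algebra_simps)
      then show ?case
        using bound[OF elim(2)] by (elim order_trans) simp
    qed
    moreover have "E \<in> O[at 0 within \<K>](\<lambda>k. k ^ p)" if "e0 \<in> O[at 0 within \<K>](\<lambda>k. k ^ p)"
    proof -
      have E: "E \<in> O[at 0 within \<K>](\<lambda>k. exp (L * T) * (e0 k + ?C * k ^ p))"
        using ev max_err_N_nonneg[OF len]
        by (intro landau_o.big_mono) (auto elim!: eventually_mono simp: E_def)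
      have "(\<lambda>k. ?C * k ^ p) \<in> O[at 0 within \<K>](\<lambda>k. k ^ p)"
        \<comment> \<open>The absolute value avoids determining the sign of
          \<open>?C\<close>.\<close>
        by (rule bigoI[where c = "\<bar>?C\<bar>"]) (simp add: abs_mult)
      with that have "(\<lambda>k. exp (L * T) * (e0 k + ?C * k ^ p)) \<in> O[at 0 within \<K>](\<lambda>k. k ^ p)"
        by (intro landau_o.big.cmult_in_iff[THEN iffD2, OF _ sum_in_bigo(1)]) simp_all
      with E show ?thesis
        by (rule landau_o.big_trans)
    qed
    ultimately show ?thesis by blast
  qed

  have "exp (L * T) * (\<Sum>j<nsteps T k. \<eta> k j) \<le> exp (L * T) * T * c / k"
    if "k \<in> \<K>" "\<forall>n<nsteps T k. \<eta> k n \<le> c" for k c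
    using mult_left_mono[OF sum_\<eta>[OF that], of "exp (L * T)"] by (simp add: mult.assoc)
  with bound order show ?thesis
    unfolding E_def e0_def p_def by blast
qed

end
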